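(* Let $b,c$ be positive integers with $\gcd(b,c)=2$ and $\frac{b+c}{2}=2^{2l-1}$ for an integer $l\ge 2$. Then: 1. For all nonnegative integers $m,n$ with $2m+n=\frac{2^{2l}-1}{3}$ there is a perfect coloring of $D(m,n)$ with quotient matrix $\begin{pmatrix} c-1 & b\\ c & b-1\end{pmatrix}$. 2. For $m$ with $2m=\frac{2^{2l}+2}{3}$ there is a perfect coloring of $D(m,0)$ with quotient matrix $\begin{pmatrix} c+2 & b\\ c & b+2\end{pmatrix}$.
   Context: The Shrikhande graph is the Cayley graph on $\mathbb{Z}_4^2$ with connection set $\{01,03,10,30,11,33\}$. For nonnegative integers $m,n$, $D(m,n)$ is the Cartesian product of $m$ copies of the Shrikhande graph and $n$ copies of $K_4$ (vertex set $(\mathbb{Z}_4^2)^m\times\mathbb{Z}_4^n$; adjacent iff differing in exactly one coordinate by an adjacency of that factor). A $2$-coloring (surjective map onto colors $\{1,2\}$) is perfect with quotient matrix $(s_{ij})$ if every vertex of color $i$ has exactly $s_{ij}$ neighbours of color $j$. *)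

theory Defs
  imports "HOL-Analysis.Cartesian_Space" "HOL-Library.FuncSet" "HOL-Library.Product_Plus"
begin

text \<open>The numeral type \<open>4\<close> is the ring of integers modulo 4.\<close>

definition cayley_adj :: "'a::ab_group_add set \<Rightarrow> 'a \<Rightarrow> 'a \<Rightarrow> bool" where
  "cayley_adj S x y \<longleftrightarrow> y - x \<in> S"

definition shrikhande_adj :: "4 \<times> 4 \<Rightarrow> 4 \<times> 4 \<Rightarrow> bool" where
  "shrikhande_adj = cayley_adj {(0,1), (0,3), (1,0), (3,0), (1,1), (3,3)}"

definition K4_adj :: "4 \<Rightarrow> 4 \<Rightarrow> bool" where
  "K4_adj x y \<longleftrightarrow> x \<noteq> y"

definition cartesian_power_adj :: "nat \<Rightarrow> ('a \<Rightarrow> 'a \<Rightarrow> bool) \<Rightarrow> (nat \<Rightarrow> 'a) \<Rightarrow> (nat \<Rightarrow> 'a) \<Rightarrow> bool" where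
  "cartesian_power_adj k adj x y \<longleftrightarrow>
     (\<exists>i<k. adj (x i) (y i) \<and> (\<forall>j<k. j \<noteq> i \<longrightarrow> x j = y j))"

text \<open>Tuples of length \<open>k\<close> are extensional functions on \<open>{..<k}\<close>, so that equality of vertices
  is equality of all coordinates.\<close>

definition doob_vertices :: "nat \<Rightarrow> nat \<Rightarrow> ((nat \<Rightarrow> 4 \<times> 4) \<times> (nat \<Rightarrow> 4)) set" where
  "doob_vertices m n = ({..<m} \<rightarrow>\<^sub>E UNIV) \<times> ({..<n} \<rightarrow>\<^sub>E UNIV)"

definition doob_adj ::
  "nat \<Rightarrow> nat \<Rightarrow> (nat \<Rightarrow> 4 \<times> 4) \<times> (nat \<Rightarrow> 4) \<Rightarrow> (nat \<Rightarrow> 4 \<times> 4) \<times> (nat \<Rightarrow> 4) \<Rightarrow> bool" where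
  "doob_adj m n u v \<longleftrightarrow>
     cartesian_power_adj m shrikhande_adj (fst u) (fst v) \<and> snd u = snd v \<or>
     fst u = fst v \<and> cartesian_power_adj n K4_adj (snd u) (snd v)"

text \<open>Colors are the elements of a finite type. For two colors this is the type \<open>2\<close>, whose elements
  are \<open>1\<close> and \<open>2\<close> (the latter equal to \<open>0\<close>), as in the library's indexing of 2-by-2 matrices.\<close>

definition perfect_coloring ::
  "'v set \<Rightarrow> ('v \<Rightarrow> 'v \<Rightarrow> bool) \<Rightarrow> ('v \<Rightarrow> 'c::finite) \<Rightarrow> nat ^ 'c ^ 'c \<Rightarrow> bool" where
  "perfect_coloring V adj f S \<longleftrightarrow>
     f ` V = UNIV \<and>
     (\<forall>v\<in>V. \<forall>j. card {w \<in> V. adj v w \<and> f w = j} = S $ (f v) $ j)"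

end

theory Submission
  imports Defs "HOL-Library.Multiset" "HOL-Library.Function_Algebras"
begin

text \<open>Map the vertices of \<open>D(m,n)\<close> to an abelian group \<open>G\<close> of order \<open>2^(2l-1)\<close> by adding up one map per
  coordinate, in such a way that the differences along the edges at every vertex hit each nonzero element
  of \<open>G\<close> exactly twice, and \<open>0\<close> exactly \<open>z\<close> times (\<open>z = 1\<close> for part 1, \<open>z = 4\<close> for part 2). The union of any
  \<open>c/2\<close> fibres is then the required color class.

  A homomorphism on a Shrikhande coordinate contributes the differences \<open>\<plusminus>a, \<plusminus>b, \<plusminus>(a+b)\<close>; a \<open>K\<^sub>4\<close> coordinate
  contributes \<open>p, q, p+q\<close> with \<open>p, q\<close> of order 2, or \<open>a, 2a, -a\<close>. If all elements of \<open>G\<close> have order at most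
  2, two \<open>K\<^sub>4\<close> coordinates can replace one Shrikhande coordinate. For \<open>l = 2\<close> there are solutions with
  \<open>(m,n) = (0,5)\<close> in \<open>Z\<^sub>2\<^sup>3\<close> and with \<open>(2,1)\<close>, \<open>(1,3)\<close> and, for part 2, \<open>(3,0)\<close> in \<open>Z\<^sub>4 \<times> Z\<^sub>2\<close>. To pass from \<open>G\<close> to
  \<open>G \<times> F\<^sub>4\<close>, with \<open>F\<^sub>4 = {0, 1, \<omega>, \<omega>+1}\<close>, add the Shrikhande coordinates with \<open>a = (g, 1)\<close> and \<open>b = (h, \<omega>)\<close>,
  where \<open>h = \<pi> g\<close> for a complete mapping \<open>\<pi>\<close>, a permutation of \<open>G\<close> for which \<open>g \<mapsto> g + \<pi> g\<close> is one too. All these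
  groups are realised inside the functions from \<open>nat\<close> to \<open>Z\<^sub>4\<close>, so that induction on \<open>l\<close> is possible.\<close>

section \<open>Additive maps on Doob graphs\<close>

text \<open>That \<open>M\<close> is the same at every vertex makes the partition into fibres of
  \<open>F\<close> equitable: the number of neighbours of \<open>v\<close> over \<open>h\<close> is
  the multiplicity of \<open>h - F v\<close> in \<open>M\<close>.\<close>

definition neighbor_differences ::
  "'v set \<Rightarrow> ('v \<Rightarrow> 'v \<Rightarrow> bool) \<Rightarrow> ('v \<Rightarrow> 'a::ab_group_add) \<Rightarrow> 'a multiset \<Rightarrow> bool" where
  "neighbor_differences V adj F M \<longleftrightarrow>
     (\<forall>v\<in>V. image_mset (\<lambda>w. F w - F v) (mset_set {w \<in> V. adj v w}) = M)"

lemma mset_set_UN_disjoint: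
  assumes "finite I" and "\<And>i. i \<in> I \<Longrightarrow> finite (S i)"
    and "\<And>i j. i \<in> I \<Longrightarrow> j \<in> I \<Longrightarrow> i \<noteq> j \<Longrightarrow> S i \<inter> S j = {}"
  shows "mset_set (\<Union>i\<in>I. S i) = (\<Sum>i\<in>I. mset_set (S i))"
  using assms
proof (induction I rule: finite_induct)
  case (insert i I)
  have "S i \<inter> (\<Union>j\<in>I. S j) = {}"
    using insert.prems(2) insert.hyps by blast
  then have "mset_set (S i \<union> (\<Union>j\<in>I. S j)) = mset_set (S i) + mset_set (\<Union>j\<in>I. S j)"
    using insert by (intro mset_set_Union) auto
  also have "mset_set (\<Union>j\<in>I. S j) = (\<Sum>j\<in>I. mset_set (S j))"
    using insert by auto
  finally show ?case
    using insert by simp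
qed simp

text \<open>An edge changes a single coordinate \<open>i\<close>, so the difference of the two sums
  collapses to a difference of \<open>\<phi> i\<close>. Irreflexivity makes the neighbour sets
  belonging to distinct coordinates disjoint, which is why the multisets add up.\<close>

lemma neighbor_differences_cartesian_power:
  fixes \<phi> :: "nat \<Rightarrow> 'v::finite \<Rightarrow> 'a::ab_group_add"
  assumes irrefl: "\<And>x. \<not> adj x x"
    and diff: "\<And>i. i < k \<Longrightarrow> neighbor_differences UNIV adj (\<phi> i) (A i)"
  shows "neighbor_differences ({..<k} \<rightarrow>\<^sub>E UNIV) (cartesian_power_adj k adj)
           (\<lambda>x. \<Sum>i<k. \<phi> i (x i)) (\<Sum>i<k. A i)"
  unfolding neighbor_differences_def
proof
  fix x :: "nat \<Rightarrow> 'v"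
  assume x: "x \<in> {..<k} \<rightarrow>\<^sub>E UNIV"
  define F where "F = (\<lambda>x::nat \<Rightarrow> 'v. \<Sum>i<k. \<phi> i (x i))"
  define S where "S i = (\<lambda>s. x(i := s)) ` {s. adj (x i) s}" for i
  have upd: "F (x(i := s)) - F x = \<phi> i s - \<phi> i (x i)" if "i < k" for i s
  proof -
    have "F (x(i := s)) = \<phi> i s + (\<Sum>j\<in>{..<k} - {i}. \<phi> j (x j))"
      unfolding F_def using that by (subst sum.remove[of _ i]) auto
    moreover have "F x = \<phi> i (x i) + (\<Sum>j\<in>{..<k} - {i}. \<phi> j (x j))"
      unfolding F_def using that by (subst sum.remove[of _ i]) auto
    ultimately show ?thesis
      by simp
  qed
  have eq: "{z \<in> {..<k} \<rightarrow>\<^sub>E UNIV. cartesian_power_adj k adj x z} = (\<Union>i\<in>{..<k}. S i)"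
  proof (intro subset_antisym subsetI)
    fix z
    assume "z \<in> {z \<in> {..<k} \<rightarrow>\<^sub>E UNIV. cartesian_power_adj k adj x z}"
    then obtain i where z: "z \<in> {..<k} \<rightarrow>\<^sub>E UNIV" and i: "i < k" "adj (x i) (z i)"
      and rest: "\<And>j. j < k \<Longrightarrow> j \<noteq> i \<Longrightarrow> x j = z j"
      unfolding cartesian_power_adj_def by blast
    have "z = x(i := z i)"
    proof
      fix j
      show "z j = (x(i := z i)) j"
        using x z rest[of j] by (cases "j < k") (auto simp: PiE_def extensional_def)
    qed
    then have "z \<in> S i"
      unfolding S_def using i by (metis (mono_tags, lifting) image_eqI mem_Collect_eq)
    then show "z \<in> (\<Union>i\<in>{..<k}. S i)"
      using i by blast
  next
    fix z
    assume "z \<in> (\<Union>i\<in>{..<k}. S i)"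
    then obtain i s where "i < k" "adj (x i) s" "z = x(i := s)"
      unfolding S_def by blast
    then show "z \<in> {z \<in> {..<k} \<rightarrow>\<^sub>E UNIV. cartesian_power_adj k adj x z}"
      using x unfolding cartesian_power_adj_def by (auto simp: PiE_def extensional_def)
  qed
  have disj: "S i \<inter> S j = {}" if "i \<noteq> j" for i j
  proof -
    have "z \<notin> S j" if "z \<in> S i" for z
    proof -
      have "z i \<noteq> x i"
        using that irrefl unfolding S_def by auto
      then show ?thesis
        using \<open>i \<noteq> j\<close> unfolding S_def by auto
    qed
    then show ?thesis
      by blast
  qed
  have part: "image_mset (\<lambda>z. F z - F x) (mset_set (S i)) = A i" if "i < k" for i
  proof -
    have "inj_on (\<lambda>s. x(i := s)) {s. adj (x i) s}"
      by (rule inj_onI) (metis fun_upd_same)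
    then have "mset_set (S i) = image_mset (\<lambda>s. x(i := s)) (mset_set {s. adj (x i) s})"
      unfolding S_def by (simp add: image_mset_mset_set)
    then have "image_mset (\<lambda>z. F z - F x) (mset_set (S i))
        = image_mset (\<lambda>s. \<phi> i s - \<phi> i (x i)) (mset_set {s. adj (x i) s})"
      using that by (simp add: multiset.map_comp comp_def upd)
    also have "\<dots> = A i"
      using diff[OF that] unfolding neighbor_differences_def by simp
    finally show ?thesis .
  qed
  have "mset_set {z \<in> {..<k} \<rightarrow>\<^sub>E UNIV. cartesian_power_adj k adj x z} = (\<Sum>i<k. mset_set (S i))"
    unfolding eq using disj by (intro mset_set_UN_disjoint) (auto simp: S_def)
  moreover have "image_mset (\<lambda>z. F z - F x) (\<Sum>i\<in>I. mset_set (S i))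
      = (\<Sum>i\<in>I. image_mset (\<lambda>z. F z - F x) (mset_set (S i)))" if "finite I" for I
    using that by (induction I rule: finite_induct) auto
  ultimately show "image_mset (\<lambda>z. (\<Sum>i<k. \<phi> i (z i)) - (\<Sum>i<k. \<phi> i (x i)))
      (mset_set {z \<in> {..<k} \<rightarrow>\<^sub>E UNIV. cartesian_power_adj k adj x z}) = (\<Sum>i<k. A i)"
    using part by (simp add: F_def)
qed

lemma shrikhande_adj_irrefl: "\<not> shrikhande_adj x x"
  by (simp add: shrikhande_adj_def cayley_adj_def zero_prod_def)

lemma K4_adj_irrefl: "\<not> K4_adj x x"
  by (simp add: K4_adj_def)

definition additive_subgroup :: "'a::ab_group_add set \<Rightarrow> bool" where
  "additive_subgroup G \<longleftrightarrow> 0 \<in> G \<and> (\<forall>x\<in>G. -x \<in> G) \<and> (\<forall>x\<in>G. \<forall>y\<in>G. x + y \<in> G)"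

lemma additive_subgroup_sum:
  assumes "additive_subgroup G" and "\<And>i. i \<in> I \<Longrightarrow> g i \<in> G"
  shows "sum g I \<in> G"
  using assms by (induction I rule: infinite_finite_induct) (auto simp: additive_subgroup_def)

text \<open>The coordinate maps are kept separate, so that a factor can be appended while only the
  total multiset \<open>M\<close> has to be remembered.\<close>

definition doob_map :: "'a::ab_group_add set \<Rightarrow> nat \<Rightarrow> nat \<Rightarrow> 'a multiset \<Rightarrow> bool" where
  "doob_map G m n M \<longleftrightarrow>
     (\<exists>\<phi> \<kappa> A B. (\<forall>i<m. range (\<phi> i) \<subseteq> G \<and> neighbor_differences UNIV shrikhande_adj (\<phi> i) (A i))
       \<and> (\<forall>j<n. range (\<kappa> j) \<subseteq> G \<and> neighbor_differences UNIV K4_adj (\<kappa> j) (B j))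
       \<and> M = (\<Sum>i<m. A i) + (\<Sum>j<n. B j))"

lemma doob_map_empty: "doob_map G 0 0 {#}"
  by (simp add: doob_map_def)

lemma doob_map_mono: "doob_map G m n M \<Longrightarrow> G \<subseteq> H \<Longrightarrow> doob_map H m n M"
  unfolding doob_map_def by (blast intro: order_trans)

lemma doob_map_Suc_shrikhande:
  assumes "doob_map G m n M" and \<psi>: "range \<psi> \<subseteq> G" "neighbor_differences UNIV shrikhande_adj \<psi> N"
  shows "doob_map G (Suc m) n (M + N)"
proof -
  obtain \<phi> \<kappa> A B where
    1: "\<forall>i<m. range (\<phi> i) \<subseteq> G \<and> neighbor_differences UNIV shrikhande_adj (\<phi> i) (A i)" and
    2: "\<forall>j<n. range (\<kappa> j) \<subseteq> G \<and> neighbor_differences UNIV K4_adj (\<kappa> j) (B j)" and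
    3: "M = (\<Sum>i<m. A i) + (\<Sum>j<n. B j)"
    using assms(1) unfolding doob_map_def by blast
  have "\<forall>i<Suc m. range ((\<phi>(m := \<psi>)) i) \<subseteq> G
      \<and> neighbor_differences UNIV shrikhande_adj ((\<phi>(m := \<psi>)) i) ((A(m := N)) i)"
    using 1 \<psi> by (simp add: less_Suc_eq)
  moreover have "(\<Sum>i<Suc m. (A(m := N)) i) = (\<Sum>i<m. A i) + N"
    by simp
  ultimately show ?thesis
    unfolding doob_map_def using 2 3
    by (intro exI[of _ "\<phi>(m := \<psi>)"] exI[of _ \<kappa>] exI[of _ "A(m := N)"] exI[of _ B]) (simp add: ac_simps)
qed

lemma doob_map_Suc_K4:
  assumes "doob_map G m n M" and \<psi>: "range \<psi> \<subseteq> G" "neighbor_differences UNIV K4_adj \<psi> N"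
  shows "doob_map G m (Suc n) (M + N)"
proof -
  obtain \<phi> \<kappa> A B where
    1: "\<forall>i<m. range (\<phi> i) \<subseteq> G \<and> neighbor_differences UNIV shrikhande_adj (\<phi> i) (A i)" and
    2: "\<forall>j<n. range (\<kappa> j) \<subseteq> G \<and> neighbor_differences UNIV K4_adj (\<kappa> j) (B j)" and
    3: "M = (\<Sum>i<m. A i) + (\<Sum>j<n. B j)"
    using assms(1) unfolding doob_map_def by blast
  have "\<forall>i<Suc n. range ((\<kappa>(n := \<psi>)) i) \<subseteq> G
      \<and> neighbor_differences UNIV K4_adj ((\<kappa>(n := \<psi>)) i) ((B(n := N)) i)"
    using 2 \<psi> by (simp add: less_Suc_eq)
  moreover have "(\<Sum>i<Suc n. (B(n := N)) i) = (\<Sum>i<n. B i) + N"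
    by simp
  ultimately show ?thesis
    unfolding doob_map_def using 1 3
    by (intro exI[of _ \<phi>] exI[of _ "\<kappa>(n := \<psi>)"] exI[of _ A] exI[of _ "B(n := N)"]) (simp add: ac_simps)
qed

text \<open>\<open>F\<close> is the sum of all coordinate maps. An edge moves either the Shrikhande
  part or the \<open>K4\<close> part, and no vertex is its own neighbour, so the neighbourhood
  splits into two disjoint pieces.\<close>

lemma doob_map_neighbor_differences:
  assumes G: "additive_subgroup G" and "doob_map G m n M"
  obtains F where "\<And>v. F v \<in> G" "neighbor_differences (doob_vertices m n) (doob_adj m n) F M"
proof -
  obtain \<phi> \<kappa> A B where
    1: "\<forall>i<m. range (\<phi> i) \<subseteq> G \<and> neighbor_differences UNIV shrikhande_adj (\<phi> i) (A i)" and
    2: "\<forall>j<n. range (\<kappa> j) \<subseteq> G \<and> neighbor_differences UNIV K4_adj (\<kappa> j) (B j)" and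
    3: "M = (\<Sum>i<m. A i) + (\<Sum>j<n. B j)"
    using assms(2) unfolding doob_map_def by blast
  define f where "f x = (\<Sum>i<m. \<phi> i (x i))" for x
  define g where "g y = (\<Sum>j<n. \<kappa> j (y j))" for y
  define F where "F v = f (fst v) + g (snd v)" for v
  have f: "neighbor_differences ({..<m} \<rightarrow>\<^sub>E UNIV) (cartesian_power_adj m shrikhande_adj) f (\<Sum>i<m. A i)"
    unfolding f_def using 1 shrikhande_adj_irrefl by (intro neighbor_differences_cartesian_power) auto
  have g: "neighbor_differences ({..<n} \<rightarrow>\<^sub>E UNIV) (cartesian_power_adj n K4_adj) g (\<Sum>j<n. B j)"
    unfolding g_def using 2 K4_adj_irrefl by (intro neighbor_differences_cartesian_power) auto
  have "F v \<in> G" for v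
  proof -
    have "\<phi> i (fst v i) \<in> G" if "i < m" for i
      using 1 that by blast
    moreover have "\<kappa> j (snd v j) \<in> G" if "j < n" for j
      using 2 that by blast
    ultimately have "f (fst v) \<in> G" "g (snd v) \<in> G"
      unfolding f_def g_def by (auto intro: additive_subgroup_sum[OF G])
    then show ?thesis
      using G by (simp add: F_def additive_subgroup_def)
  qed
  moreover have "image_mset (\<lambda>w. F w - F v) (mset_set {w \<in> doob_vertices m n. doob_adj m n v w}) = M"
    if "v \<in> doob_vertices m n" for v
  proof -
    obtain x y where v: "v = (x, y)"
      by fastforce
    have x: "x \<in> {..<m} \<rightarrow>\<^sub>E UNIV" and y: "y \<in> {..<n} \<rightarrow>\<^sub>E UNIV"
      using that by (auto simp: v doob_vertices_def)
    let ?X = "{z \<in> {..<m} \<rightarrow>\<^sub>E UNIV. cartesian_power_adj m shrikhande_adj x z}"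
    let ?Y = "{z \<in> {..<n} \<rightarrow>\<^sub>E UNIV. cartesian_power_adj n K4_adj y z}"
    have fin: "finite ?X" "finite ?Y"
      by (simp_all add: finite_PiE)
    have "{w \<in> doob_vertices m n. doob_adj m n v w} = (\<lambda>z. (z, y)) ` ?X \<union> Pair x ` ?Y"
      using x y by (auto simp: v doob_vertices_def doob_adj_def)
    moreover have "x \<notin> ?X"
      using shrikhande_adj_irrefl by (auto simp: cartesian_power_adj_def)
    ultimately have "mset_set {w \<in> doob_vertices m n. doob_adj m n v w}
        = mset_set ((\<lambda>z. (z, y)) ` ?X) + mset_set (Pair x ` ?Y)"
      using fin by (simp only:) (rule mset_set_Union, auto)
    also have "\<dots> = image_mset (\<lambda>z. (z, y)) (mset_set ?X) + image_mset (Pair x) (mset_set ?Y)"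
      by (simp add: image_mset_mset_set inj_on_def)
    finally show ?thesis
      using f g x y unfolding neighbor_differences_def
      by (simp add: 3 multiset.map_comp comp_def F_def v)
  qed
  ultimately show ?thesis
    using that unfolding neighbor_differences_def by blast
qed

section \<open>Two-colorings from fibres\<close>

text \<open>For finite \<open>G\<close> the size \<open>z + 2 * (card G - 1)\<close> has to equal
  the degree \<open>6 * m + 3 * n\<close>. With \<open>card G = 2 ^ (2 * l - 1)\<close> this is the
  condition of part 1 for \<open>z = 1\<close> and that of part 2 for \<open>z = 4\<close>.\<close>

definition twofold_mset :: "nat \<Rightarrow> 'a::ab_group_add set \<Rightarrow> 'a multiset" where
  "twofold_mset z G = replicate_mset z 0 + (mset_set (G - {0}) + mset_set (G - {0}))"

text \<open>The shift \<open>d \<mapsto> g + d\<close> matches the nonzero differences leading into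
  \<open>U\<close> with \<open>U - {g}\<close>, each counted twice. The \<open>z\<close> zero
  differences stay at \<open>g\<close>, hence count only if \<open>g \<in> U\<close>.\<close>

lemma size_filter_twofold_mset:
  assumes G: "additive_subgroup G" "finite G" and "U \<subseteq> G" "g \<in> G"
  shows "size (filter_mset (\<lambda>d. g + d \<in> U) (twofold_mset z G))
    = 2 * card (U - {g}) + (if g \<in> U then z else 0)"
proof -
  have diff: "x - g \<in> G" if "x \<in> G" for x
    using that assms(1,4) unfolding additive_subgroup_def by (metis add_uminus_conv_diff)
  have "bij_betw (\<lambda>d. g + d) {d \<in> G - {0}. g + d \<in> U} (U - {g})"
  proof (rule bij_betw_byWitness[where f' = "\<lambda>x. x + (- g)"])
    show "(\<lambda>x. x + - g) ` (U - {g}) \<subseteq> {d \<in> G - {0}. g + d \<in> U}"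
      using assms(3) diff by auto
  qed auto
  then have "card {d \<in> G - {0}. g + d \<in> U} = card (U - {g})"
    by (rule bij_betw_same_card)
  moreover have "filter_mset (\<lambda>d. g + d \<in> U) (replicate_mset z 0) = (if g \<in> U then replicate_mset z 0 else {#})"
    by (induction z) auto
  ultimately show ?thesis
    using G by (simp add: twofold_mset_def)
qed

text \<open>Color 1 is the preimage of \<open>T\<close>. A vertex over \<open>g\<close> has
  \<open>z\<close> neighbours over \<open>g\<close> itself and two over every other element, whence
  the \<open>- 1\<close> in the diagonal entries.\<close>

lemma perfect_coloring_of_doob_map:
  assumes G: "additive_subgroup G" "finite G" and "doob_map G m n (twofold_mset z G)"
    and T: "T \<subseteq> G" "T \<noteq> {}" "T \<noteq> G"
  shows "\<exists>f :: _ \<Rightarrow> 2. perfect_coloring (doob_vertices m n) (doob_adj m n) f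
    (vector [vector [2 * (card T - 1) + z, 2 * card (G - T)],
             vector [2 * card T, 2 * (card (G - T) - 1) + z]])"
proof -
  let ?V = "doob_vertices m n"
  obtain F where F: "\<And>v. F v \<in> G" "neighbor_differences ?V (doob_adj m n) F (twofold_mset z G)"
    using doob_map_neighbor_differences[OF G(1) assms(3)] by blast
  have "finite ?V"
    unfolding doob_vertices_def by (simp add: finite_PiE)
  have count: "card {w \<in> ?V. doob_adj m n v w \<and> F w \<in> U} = 2 * card (U - {F v}) + (if F v \<in> U then z else 0)"
    if "v \<in> ?V" "U \<subseteq> G" for v U
  proof -
    let ?N = "{w \<in> ?V. doob_adj m n v w}"
    have "card {w \<in> ?V. doob_adj m n v w \<and> F w \<in> U} = size (filter_mset (\<lambda>w. F w \<in> U) (mset_set ?N))"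
      using \<open>finite ?V\<close> by (simp add: filter_mset_mset_set conj_assoc)
    also have "\<dots> = size (filter_mset (\<lambda>d. F v + d \<in> U) (image_mset (\<lambda>w. F w - F v) (mset_set ?N)))"
      by (simp add: filter_mset_image_mset)
    also have "\<dots> = 2 * card (U - {F v}) + (if F v \<in> U then z else 0)"
      using F that size_filter_twofold_mset[OF G] unfolding neighbor_differences_def by simp
    finally show ?thesis .
  qed
  \<comment> \<open>Needed for surjectivity of the coloring: a vertex whose value lies outside
    \<open>U\<close> already has two neighbours over each element of \<open>U\<close>.\<close>
  have hit: "\<exists>v\<in>?V. F v \<in> U" if U: "U \<subseteq> G" "U \<noteq> {}" for U
  proof -
    have "?V \<noteq> {}"
      unfolding doob_vertices_def by (simp add: Sigma_empty_iff PiE_eq_empty_iff)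
    then obtain v where v: "v \<in> ?V"
      by blast
    show ?thesis
    proof (cases "F v \<in> U")
      case False
      then have "card {w \<in> ?V. doob_adj m n v w \<and> F w \<in> U} > 0"
        using count[OF v U(1)] U G(2) finite_subset by (auto simp: card_gt_0_iff)
      then show ?thesis
        by (auto simp: card_gt_0_iff)
    qed (use v in blast)
  qed
  define f :: "_ \<Rightarrow> 2" where "f v = (if F v \<in> T then 1 else 2)" for v
  have f1: "f v = 1 \<longleftrightarrow> F v \<in> T" and f2: "f v = 2 \<longleftrightarrow> F v \<in> G - T" for v
    using F(1) by (auto simp: f_def)
  have "f ` ?V = UNIV"
  proof -
    obtain v w where "v \<in> ?V" "F v \<in> T" "w \<in> ?V" "F w \<in> G - T"
      using hit[of T] hit[of "G - T"] T by blast
    then have "f v = 1" "f w = 2" "{f v, f w} \<subseteq> f ` ?V"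
      using f1[of v] f2[of w] by simp_all
    then show ?thesis
      using UNIV_2 by (simp add: top.extremum_unique)
  qed
  moreover have "card {w \<in> ?V. doob_adj m n v w \<and> f w = j}
      = vector [vector [2 * (card T - 1) + z, 2 * card (G - T)],
             vector [2 * card T, 2 * (card (G - T) - 1) + z]] $ (f v) $ j"
    if v: "v \<in> ?V" for v and j :: 2
  proof -
    have "card {w \<in> ?V. doob_adj m n v w \<and> f w = 1} = 2 * card (T - {F v}) + (if F v \<in> T then z else 0)"
      unfolding f1 by (rule count[OF v T(1)])
    moreover have "card {w \<in> ?V. doob_adj m n v w \<and> f w = 2}
        = 2 * card (G - T - {F v}) + (if F v \<in> G - T then z else 0)"
      unfolding f2 by (rule count[OF v]) blast
    moreover have "j = 1 \<or> j = 2"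
      by (rule exhaust_2)
    moreover have "f v = 1 \<and> F v \<in> T \<or> f v = 2 \<and> F v \<in> G - T"
      using f1[of v] f2[of v] F(1)[of v] by blast
    ultimately show ?thesis
      using G(2) finite_subset[OF T(1) G(2)] by (elim disjE conjE) simp_all
  qed
  ultimately show ?thesis
    unfolding perfect_coloring_def by blast
qed

section \<open>Scalar multiples over the integers modulo 4\<close>

lemma Z4_cases: "x = 0 \<or> x = 1 \<or> x = 2 \<or> x = (3::4)"
  using exhaust_4[of x] by auto

lemma three_Z4: "3 * x = - (x::4)"
  using Z4_cases[of x] by auto

lemma additive_subgroup_scale:
  fixes G :: "(nat \<Rightarrow> 4) set" and p :: 4
  assumes "additive_subgroup G" and "a \<in> G"
  shows "(\<lambda>i. p * a i) \<in> G"
proof -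
  have "(\<lambda>i. 2 * a i) = a + a"
    by (rule ext) (simp only: mult_2 plus_fun_apply)
  then have "(\<lambda>i. 2 * a i) \<in> G"
    using assms unfolding additive_subgroup_def by (simp only:)
  moreover have "(\<lambda>i. 3 * a i) = - a"
    using three_Z4 by (simp add: fun_eq_iff)
  then have "(\<lambda>i. 3 * a i) \<in> G"
    using assms unfolding additive_subgroup_def by (simp only:)
  moreover have "(\<lambda>i. 0) = (0::nat \<Rightarrow> 4)"
    by (simp add: fun_eq_iff)
  then have "(\<lambda>i. 0 * a i) \<in> G"
    using assms unfolding additive_subgroup_def by simp
  moreover have "(\<lambda>i. 1 * a i) \<in> G"
    using assms by simp
  ultimately show ?thesis
    using Z4_cases[of p] by blast
qed

section \<open>Maps on a single coordinate\<close>

text \<open>The image of the connection set under the homomorphism with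
  \<open>(1, 0) \<mapsto> a\<close> and \<open>(0, 1) \<mapsto> b\<close>; the coefficient 3 becomes
  a minus sign.\<close>

definition shrikhande_mset :: "'a::ab_group_add \<Rightarrow> 'a \<Rightarrow> 'a multiset" where
  "shrikhande_mset a b = {#a, - a, b, - b, a + b, - (a + b)#}"

lemma translate_eq_Collect:
  fixes x :: "'a::ab_group_add"
  shows "(\<lambda>s. x + s) ` S = {y. y - x \<in> S}"
proof (intro subset_antisym subsetI)
  fix y
  assume "y \<in> {y. y - x \<in> S}"
  then have "x + (y - x) \<in> (\<lambda>s. x + s) ` S"
    by blast
  then show "y \<in> (\<lambda>s. x + s) ` S"
    by simp
qed auto

text \<open>The map is a homomorphism, so its difference along the edge from \<open>x\<close> to
  \<open>x + s\<close> is its value at \<open>s\<close>, whatever \<open>x\<close> is.\<close>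

lemma neighbor_differences_shrikhande:
  fixes a b :: "nat \<Rightarrow> 4"
  shows "neighbor_differences UNIV shrikhande_adj (\<lambda>(p, q) i. p * a i + q * b i) (shrikhande_mset a b)"
    (is "neighbor_differences _ _ ?\<phi> _")
  unfolding neighbor_differences_def
proof
  fix x :: "4 \<times> 4"
  let ?S = "{(0,1), (0,3), (1,0), (3,0), (1,1), (3,3)} :: (4 \<times> 4) set"
  have "{y \<in> UNIV. shrikhande_adj x y} = (\<lambda>s. x + s) ` ?S"
    unfolding translate_eq_Collect by (simp add: shrikhande_adj_def cayley_adj_def)
  then have "mset_set {y \<in> UNIV. shrikhande_adj x y} = image_mset (\<lambda>s. x + s) (mset_set ?S)"
    by (simp only: image_mset_mset_set inj_on_add)
  moreover have "?\<phi> (x + s) - ?\<phi> x = ?\<phi> s" for s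
    by (cases x; cases s) (simp add: fun_eq_iff algebra_simps)
  moreover have "mset_set ?S = {#(0,1), (0,3), (1,0), (3,0), (1,1), (3,3)#}"
    by simp
  ultimately show "image_mset (\<lambda>y. ?\<phi> y - ?\<phi> x) (mset_set {y \<in> UNIV. shrikhande_adj x y}) = shrikhande_mset a b"
    by (simp add: multiset.map_comp comp_def shrikhande_mset_def three_Z4 plus_fun_def fun_Compl_def minus_diff_commute)
qed

text \<open>Here \<open>K4\<close> is viewed as the Cayley graph of the cyclic group of order 4 with
  connection set \<open>{1, 2, 3}\<close>.\<close>

lemma neighbor_differences_K4_cyclic:
  fixes a :: "nat \<Rightarrow> 4"
  shows "neighbor_differences UNIV K4_adj (\<lambda>p i. p * a i) {#a, a + a, - a#}"
    (is "neighbor_differences _ _ ?\<phi> _")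
  unfolding neighbor_differences_def
proof
  fix x :: 4
  have "{y \<in> UNIV. K4_adj x y} = (\<lambda>s. x + s) ` {1, 2, 3}"
  proof -
    have "x \<noteq> y \<longleftrightarrow> y - x \<in> {1, 2, 3}" for y
      using Z4_cases[of "y - x"] by auto
    then show ?thesis
      unfolding translate_eq_Collect by (simp add: K4_adj_def)
  qed
  then have "mset_set {y \<in> UNIV. K4_adj x y} = image_mset (\<lambda>s. x + s) (mset_set {1, 2, 3})"
    by (simp only: image_mset_mset_set inj_on_add)
  moreover have "?\<phi> (x + s) - ?\<phi> x = ?\<phi> s" for s
    by (simp add: fun_eq_iff algebra_simps)
  moreover have "mset_set {1, 2, 3::4} = {#1, 2, 3#}"
    by simp
  ultimately show "image_mset (\<lambda>y. ?\<phi> y - ?\<phi> x) (mset_set {y \<in> UNIV. K4_adj x y}) = {#a, a + a, - a#}"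
    by (simp add: multiset.map_comp comp_def three_Z4 plus_fun_def fun_Compl_def)
qed

text \<open>Here \<open>K4\<close> is viewed as a Cayley graph of the Klein four-group. The
  labelling is in general not a homomorphism on the integers modulo 4, so the four base vertices are
  checked one by one, using that subtracting \<open>p\<close> or \<open>q\<close> is the same as
  adding it.\<close>

lemma neighbor_differences_K4_elementary:
  fixes p q :: "'a::ab_group_add"
  assumes "p + p = 0" and "q + q = 0"
  shows "neighbor_differences UNIV K4_adj
    (\<lambda>x. if x = 0 then 0 else if x = 1 then p else if x = 2 then q else p + q) {#p, q, p + q#}"
  unfolding neighbor_differences_def
proof
  fix x :: 4
  have neg: "- p = p" "- q = q"
    using assms by (simp_all add: minus_unique)
  have sub: "x - p = x + p" "x - q = x + q" for x
    using neg by (simp_all only: diff_conv_add_uminus)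
  have cancel: "p + (p + x) = x" "q + (q + x) = x" for x
    using assms by (metis add.assoc add_0)+
  have U: "(UNIV::4 set) = {0, 1, 2, 3}"
    using Z4_cases by blast
  then have "{y \<in> UNIV. K4_adj x y} = {0, 1, 2, 3} - {x}"
    by (auto simp: K4_adj_def)
  then show "image_mset
      (\<lambda>y. (if y = 0 then 0 else if y = 1 then p else if y = 2 then q else p + q)
         - (if x = 0 then 0 else if x = 1 then p else if x = 2 then q else p + q))
      (mset_set {y \<in> UNIV. K4_adj x y}) = {#p, q, p + q#}"
    using Z4_cases[of x] assms by (elim disjE) (simp_all add: insert_Diff_if neg sub cancel ac_simps diff_add_eq_diff_diff_swap add_mset_commute)
qed

section \<open>Appending coordinates, singly and in families\<close>

lemma doob_map_add_shrikhande:
  fixes G :: "(nat \<Rightarrow> 4) set"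
  assumes G: "additive_subgroup G" and "doob_map G m n M" and "a \<in> G" "b \<in> G"
  shows "doob_map G (Suc m) n (M + shrikhande_mset a b)"
proof (rule doob_map_Suc_shrikhande[OF assms(2) _ neighbor_differences_shrikhande])
  have "(\<lambda>i. p * a i + q * b i) \<in> G" for p q
  proof -
    have "(\<lambda>i. p * a i) + (\<lambda>i. q * b i) \<in> G"
      using additive_subgroup_scale[OF G] assms(3,4) G unfolding additive_subgroup_def by blast
    then show ?thesis
      by (simp add: plus_fun_def)
  qed
  then show "range (\<lambda>(p, q) i. p * a i + q * b i) \<subseteq> G"
    by auto
qed

lemma doob_map_add_K4_cyclic:
  fixes G :: "(nat \<Rightarrow> 4) set"
  assumes G: "additive_subgroup G" and "doob_map G m n M" and "a \<in> G"
  shows "doob_map G m (Suc n) (M + {#a, a + a, - a#})"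
  using additive_subgroup_scale[OF G assms(3)]
  by (intro doob_map_Suc_K4[OF assms(2) _ neighbor_differences_K4_cyclic]) blast

lemma doob_map_add_K4_elementary:
  assumes G: "additive_subgroup G" and "doob_map G m n M" and "p \<in> G" "q \<in> G" "p + p = 0" "q + q = 0"
  shows "doob_map G m (Suc n) (M + {#p, q, p + q#})"
  using assms unfolding additive_subgroup_def
  by (intro doob_map_Suc_K4[OF assms(2) _ neighbor_differences_K4_elementary]) auto

definition elementary :: "'a::ab_group_add set \<Rightarrow> bool" where
  "elementary G \<longleftrightarrow> (\<forall>x\<in>G. x + x = 0)"

lemma doob_map_add_family_shrikhande:
  fixes G :: "(nat \<Rightarrow> 4) set"
  assumes G: "additive_subgroup G" and "doob_map G m n M"
    and "finite I" and "\<And>i. i \<in> I \<Longrightarrow> a i \<in> G \<and> b i \<in> G"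
  shows "doob_map G (m + card I) n (M + (\<Sum>i\<in>I. shrikhande_mset (a i) (b i)))"
  using assms(3,4)
proof (induction I rule: finite_induct)
  case (insert i I)
  then have "doob_map G (Suc (m + card I)) n
      (M + (\<Sum>i\<in>I. shrikhande_mset (a i) (b i)) + shrikhande_mset (a i) (b i))"
    by (intro doob_map_add_shrikhande[OF G]) auto
  then show ?case
    using insert.hyps by (simp add: ac_simps)
qed (use assms(2) in simp)

text \<open>When \<open>- x = x\<close>, the six differences of a Shrikhande coordinate are
  \<open>{#a, b, a + b#}\<close> taken twice, which two \<open>K4\<close> coordinates produce as
  well.\<close>

lemma doob_map_add_family_K4:
  fixes G :: "(nat \<Rightarrow> 4) set"
  assumes G: "additive_subgroup G" "elementary G" and "doob_map G m n M"
    and "finite I" and "\<And>i. i \<in> I \<Longrightarrow> a i \<in> G \<and> b i \<in> G"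
  shows "doob_map G m (n + 2 * card I) (M + (\<Sum>i\<in>I. shrikhande_mset (a i) (b i)))"
  using assms(4,5)
proof (induction I rule: finite_induct)
  case (insert i I)
  let ?M = "M + (\<Sum>i\<in>I. shrikhande_mset (a i) (b i))" and ?L = "{#a i, b i, a i + b i#}"
  have ab: "a i \<in> G" "b i \<in> G" "a i + a i = 0" "b i + b i = 0"
    using insert.prems G(2) unfolding elementary_def by auto
  then have neg: "- a i = a i" "- b i = b i" "- (a i + b i) = a i + b i"
    by (simp_all add: minus_unique minus_add)
  then have "shrikhande_mset (a i) (b i) = ?L + ?L"
    unfolding shrikhande_mset_def neg by (simp add: add_mset_commute)
  then have "M + (\<Sum>i\<in>insert i I. shrikhande_mset (a i) (b i)) = ?M + ?L + ?L"
    unfolding sum.insert[OF insert.hyps(1,2)] by (simp only: ac_simps)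
  moreover have "doob_map G m (Suc (Suc (n + 2 * card I))) (?M + ?L + ?L)"
    using insert ab by (intro doob_map_add_K4_elementary[OF G(1)]) auto
  moreover have "n + 2 * card (insert i I) = Suc (Suc (n + 2 * card I))"
    using insert.hyps by simp
  ultimately show ?case
    by (simp only:)
qed (use assms(3) in simp)

text \<open>Any \<open>j\<close> of the indices are realised by Shrikhande coordinates, and each
  remaining one is traded for two \<open>K4\<close> coordinates. The trade rests on
  \<open>elementary G\<close>; otherwise all indices stay Shrikhande.\<close>

lemma doob_map_add_family:
  fixes G :: "(nat \<Rightarrow> 4) set"
  assumes G: "additive_subgroup G" and "doob_map G m n M"
    and I: "finite I" and ab: "\<And>i. i \<in> I \<Longrightarrow> a i \<in> G \<and> b i \<in> G"
    and j: "j \<le> card I" "elementary G \<or> j = card I"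
  shows "doob_map G (m + j) (n + 2 * (card I - j)) (M + (\<Sum>i\<in>I. shrikhande_mset (a i) (b i)))"
proof (cases "j = card I")
  case True
  then show ?thesis
    using doob_map_add_family_shrikhande[OF assms(1-4)] by simp
next
  case False
  then have "elementary G"
    using j by blast
  obtain J where J: "J \<subseteq> I" "card J = j" "finite J"
    using j(1) by (rule obtain_subset_with_card_n)
  have "doob_map G (m + card J) n (M + (\<Sum>i\<in>J. shrikhande_mset (a i) (b i)))"
    using J ab by (intro doob_map_add_family_shrikhande[OF assms(1,2)]) auto
  then have "doob_map G (m + card J) (n + 2 * card (I - J))
     (M + (\<Sum>i\<in>J. shrikhande_mset (a i) (b i)) + (\<Sum>i\<in>I - J. shrikhande_mset (a i) (b i)))"
    using I ab by (intro doob_map_add_family_K4[OF G \<open>elementary G\<close>]) auto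
  moreover have "card (I - J) = card I - j"
    using J by (simp add: card_Diff_subset)
  ultimately show ?thesis
    using sum.subset_diff[OF J(1) I, of "\<lambda>i. shrikhande_mset (a i) (b i)"] J(2) by (simp add: ac_simps)
qed

section \<open>Extending the group\<close>

definition append_pair :: "nat \<Rightarrow> (nat \<Rightarrow> 4) \<Rightarrow> 4 \<Rightarrow> 4 \<Rightarrow> nat \<Rightarrow> 4" where
  "append_pair k g u v = g(k := u, Suc k := v)"

lemma append_pair_add: "append_pair k g u v + append_pair k h u' v' = append_pair k (g + h) (u + u') (v + v')"
  by (simp add: append_pair_def fun_eq_iff)

lemma append_pair_minus: "- append_pair k g u v = append_pair k (- g) (- u) (- v)"
  by (simp add: append_pair_def fun_eq_iff)

lemma append_pair_0: "\<forall>i\<ge>k. g i = 0 \<Longrightarrow> append_pair k g 0 0 = g"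
  by (simp add: append_pair_def fun_eq_iff)

lemma append_pair_eq_iff:
  assumes "\<forall>i\<ge>k. g i = 0" and "\<forall>i\<ge>k. h i = 0"
  shows "append_pair k g u v = append_pair k h u' v' \<longleftrightarrow> g = h \<and> u = u' \<and> v = v'"
proof
  assume eq: "append_pair k g u v = append_pair k h u' v'"
  have "g i = h i" for i
    using fun_cong[OF eq, of i] assms by (cases "i < k") (simp_all add: append_pair_def)
  moreover have "u = u'" "v = v'"
    using fun_cong[OF eq, of k] fun_cong[OF eq, of "Suc k"] by (simp_all add: append_pair_def)
  ultimately show "g = h \<and> u = u' \<and> v = v'"
    by blast
qed simp

text \<open>This is \<open>G \<times> F_4\<close> with \<open>1\<close> encoded as
  \<open>(2, 0)\<close> and \<open>\<omega>\<close> as \<open>(0, 2)\<close> in the positions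
  \<open>k\<close> and \<open>Suc k\<close>, which are free when the elements of \<open>G\<close>
  vanish from \<open>k\<close> on.\<close>

definition extend :: "nat \<Rightarrow> (nat \<Rightarrow> 4) set \<Rightarrow> (nat \<Rightarrow> 4) set" where
  "extend k G = {append_pair k g u v | g u v. g \<in> G \<and> u \<in> {0, 2} \<and> v \<in> {0, 2}}"

lemma extend_eq_image: "extend k G = (\<lambda>(g, u, v). append_pair k g u v) ` (G \<times> {0, 2} \<times> {0, 2})"
proof (intro subset_antisym subsetI)
  fix x
  assume "x \<in> extend k G"
  then obtain g u v where "x = append_pair k g u v" "(g, u, v) \<in> G \<times> {0, 2} \<times> {0, 2}"
    unfolding extend_def by blast
  then show "x \<in> (\<lambda>(g, u, v). append_pair k g u v) ` (G \<times> {0, 2} \<times> {0, 2})"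
    by (metis (no_types, lifting) case_prod_conv image_eqI)
qed (auto simp: extend_def)

text \<open>The set \<open>P\<close> is the graph of a complete mapping of \<open>G\<close>.\<close>

definition admissible :: "nat \<Rightarrow> (nat \<Rightarrow> 4) set \<Rightarrow> bool" where
  "admissible k G \<longleftrightarrow> additive_subgroup G \<and> finite G \<and> (\<forall>g\<in>G. \<forall>i\<ge>k. g i = 0)
     \<and> (\<exists>P. bij_betw fst P G \<and> bij_betw snd P G \<and> bij_betw (\<lambda>(g, h). g + h) P G)"

lemma bij_betw_append_pair:
  assumes "\<forall>g\<in>G. \<forall>i\<ge>k. g i = 0"
  shows "bij_betw (\<lambda>(g, u, v). append_pair k g u v) (G \<times> {0, 2} \<times> {0, 2}) (extend k G)"
  unfolding bij_betw_def extend_eq_image using assms by (auto intro!: inj_onI simp: append_pair_eq_iff)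

lemma additive_subgroup_extend:
  assumes G: "additive_subgroup G"
  shows "additive_subgroup (extend k G)"
proof -
  have mem: "append_pair k g u v \<in> extend k G" if "g \<in> G" "u \<in> {0, 2}" "v \<in> {0, 2}" for g u v
    unfolding extend_def using that by blast
  have "0 = append_pair k 0 0 0"
    by (simp add: append_pair_def fun_eq_iff)
  then have "0 \<in> extend k G"
    using mem[of 0 0 0] G by (simp add: additive_subgroup_def)
  moreover have "- x \<in> extend k G" if x: "x \<in> extend k G" for x
  proof -
    obtain g u v where *: "g \<in> G" "u \<in> {0, 2}" "v \<in> {0, 2}" "x = append_pair k g u v"
      using x unfolding extend_def by blast
    have "- g \<in> G"
      using *(1) G unfolding additive_subgroup_def by blast
    moreover have "- u \<in> {0, 2}" "- v \<in> {0, 2}"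
      using *(2,3) by auto
    ultimately show ?thesis
      unfolding *(4) append_pair_minus by (rule mem)
  qed
  moreover have "x + y \<in> extend k G" if x: "x \<in> extend k G" and y: "y \<in> extend k G" for x y
  proof -
    obtain g u v where 1: "g \<in> G" "u \<in> {0, 2}" "v \<in> {0, 2}" "x = append_pair k g u v"
      using x unfolding extend_def by blast
    obtain h u' v' where 2: "h \<in> G" "u' \<in> {0, 2}" "v' \<in> {0, 2}" "y = append_pair k h u' v'"
      using y unfolding extend_def by blast
    have "g + h \<in> G"
      using 1(1) 2(1) G unfolding additive_subgroup_def by blast
    moreover have "u + u' \<in> {0, 2}" "v + v' \<in> {0, 2}"
      using 1(2,3) 2(2,3) by auto
    ultimately show ?thesis
      unfolding 1(4) 2(4) append_pair_add by (rule mem)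
  qed
  ultimately show ?thesis
    unfolding additive_subgroup_def by blast
qed

lemma elementary_extend:
  assumes "elementary G"
  shows "elementary (extend k G)"
proof -
  have "append_pair k g u v + append_pair k g u v = 0" if "g \<in> G" "u \<in> {0, 2}" "v \<in> {0, 2}" for g u v
  proof -
    have "u + u = 0" "v + v = 0"
      using that by auto
    moreover have "g + g = 0"
      using that assms unfolding elementary_def by blast
    ultimately show ?thesis
      unfolding append_pair_add by (simp add: append_pair_def fun_eq_iff)
  qed
  then show ?thesis
    unfolding elementary_def extend_def by auto
qed

lemma bij_betw_image_comp: "bij_betw (f \<circ> g) D B \<Longrightarrow> bij_betw f (g ` D) B"
  by (auto simp: bij_betw_def image_comp intro: inj_on_imageI)

text \<open>On the new pair of coordinates, which form the additive group of the field with four elements,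
  multiplication by a primitive element serves as complete mapping.\<close>

lemma admissible_extend:
  assumes "admissible k G"
  shows "admissible (k + 2) (extend k G)"
proof -
  have G: "additive_subgroup G" "finite G" and supp: "\<forall>g\<in>G. \<forall>i\<ge>k. g i = 0"
    using assms unfolding admissible_def by blast+
  obtain P where P: "bij_betw fst P G" "bij_betw snd P G" "bij_betw (\<lambda>(g, h). g + h) P G"
    using assms unfolding admissible_def by blast
  let ?H = "{0, 2 :: 4} \<times> {0, 2 :: 4}"
  let ?c = "\<lambda>(g, u, v). append_pair k g u v"
  define \<Psi> where "\<Psi> = (\<lambda>((g, h), u, v). (append_pair k g u v, append_pair k h v (u + v)))"
  \<comment> \<open>With 2 standing for the coefficient 1, these are the multiplications of
    \<open>u + v \<omega>\<close> by \<open>1\<close>, \<open>\<omega>\<close> and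
    \<open>\<omega> + 1\<close>, all nonzero in \<open>F_4\<close>.\<close>
  have H: "bij_betw (\<lambda>(u, v). (u, v)) ?H ?H" "bij_betw (\<lambda>(u, v). (v, u + v)) ?H ?H"
    "bij_betw (\<lambda>(u, v). (u + v, v + (u + v))) ?H ?H"
    by (auto simp: bij_betw_def inj_on_def)
  have comp: "bij_betw (?c \<circ> map_prod f w) (P \<times> ?H) (extend k G)"
    if "bij_betw f P G" "bij_betw w ?H ?H" for f w
    using bij_betw_append_pair[OF supp] that by (intro bij_betw_trans[OF bij_betw_map_prod]) auto
  have "bij_betw (fst \<circ> \<Psi>) (P \<times> ?H) (extend k G)"
    using comp[OF P(1) H(1)] by (rule bij_betw_cong[THEN iffD1, rotated]) (auto simp: \<Psi>_def)
  moreover have "bij_betw (snd \<circ> \<Psi>) (P \<times> ?H) (extend k G)"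
    using comp[OF P(2) H(2)] by (rule bij_betw_cong[THEN iffD1, rotated]) (auto simp: \<Psi>_def)
  moreover have "bij_betw ((\<lambda>(g, h). g + h) \<circ> \<Psi>) (P \<times> ?H) (extend k G)"
    using comp[OF P(3) H(3)]
    by (rule bij_betw_cong[THEN iffD1, rotated]) (clarsimp simp only: \<Psi>_def comp_def map_prod_simp prod.case append_pair_add)
  ultimately have "\<exists>P. bij_betw fst P (extend k G) \<and> bij_betw snd P (extend k G)
      \<and> bij_betw (\<lambda>(g, h). g + h) P (extend k G)"
    by (intro exI[of _ "\<Psi> ` (P \<times> ?H)"] conjI bij_betw_image_comp)
  moreover have "x i = 0" if "x \<in> extend k G" "i \<ge> k + 2" for x i
    using that supp by (auto simp: extend_def append_pair_def)
  moreover have "finite (extend k G)"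
    using G by (simp add: extend_eq_image)
  ultimately show ?thesis
    using additive_subgroup_extend[OF G(1)] unfolding admissible_def by blast
qed

lemma card_extend:
  assumes "admissible k G"
  shows "card (extend k G) = 4 * card G"
proof -
  have "card (extend k G) = card (G \<times> {0, 2 :: 4} \<times> {0, 2 :: 4})"
    using assms unfolding admissible_def by (intro bij_betw_same_card[OF bij_betw_append_pair, symmetric]) blast
  then show ?thesis
    by (simp add: card_cartesian_product)
qed

section \<open>The multiset identity for one extension step\<close>

lemma sum_singleton_mset:
  assumes "bij_betw f P G"
  shows "(\<Sum>x\<in>P. {#c (f x)#}) = image_mset c (mset_set G)"
proof -
  have "(\<Sum>x\<in>P. {#c (f x)#}) = (\<Sum>g\<in>G. {#c g#})"
    using assms by (rule sum.reindex_bij_betw)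
  also have "\<dots> = image_mset c (mset_set G)"
    by (induction G rule: infinite_finite_induct) auto
  finally show ?thesis .
qed

text \<open>The new elements form three cosets of \<open>G\<close>, one for each nonzero element of
  \<open>F_4\<close>. As \<open>x\<close> runs through \<open>P\<close>, the first argument runs
  once through the coset of \<open>1\<close>, and so does its negative because
  \<open>- 2 = 2\<close> modulo 4. The second argument and the sum do the same for
  \<open>\<omega>\<close> and \<open>\<omega> + 1\<close>, by bijectivity of \<open>snd\<close> and
  of addition on \<open>P\<close>. So each coset is covered exactly twice.\<close>

lemma twofold_mset_extend:
  assumes adm: "admissible k G"
    and P: "bij_betw fst P G" "bij_betw snd P G" "bij_betw (\<lambda>(g, h). g + h) P G"
  shows "twofold_mset z (extend k G) = twofold_mset z G
    + (\<Sum>x\<in>P. shrikhande_mset (append_pair k (fst x) 2 0) (append_pair k (snd x) 0 2))"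
proof -
  have G: "additive_subgroup G" "finite G" and supp: "\<forall>g\<in>G. \<forall>i\<ge>k. g i = 0"
    using adm unfolding admissible_def by blast+
  define C where "C u v = (\<lambda>g. append_pair k g u v) ` G" for u v
  have C: "image_mset (\<lambda>g. append_pair k g u v) (mset_set G) = mset_set (C u v)" for u v
    unfolding C_def using supp append_pair_eq_iff by (intro image_mset_mset_set inj_onI) blast
  have disj: "C u v \<inter> C u' v' = {}" if "(u, v) \<noteq> (u', v')" for u v u' v'
    using that supp append_pair_eq_iff unfolding C_def by blast
  have "C 0 0 = G"
    unfolding C_def using supp append_pair_0 by simp
  have "0 \<in> G"
    using G by (simp add: additive_subgroup_def)
  have "extend k G = C 0 0 \<union> C 2 0 \<union> C 0 2 \<union> C 2 2"
    unfolding extend_def C_def by auto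
  moreover have "0 \<notin> C 2 0" "0 \<notin> C 0 2" "0 \<notin> C 2 2"
    using disj[of 2 0 0 0] disj[of 0 2 0 0] disj[of 2 2 0 0] \<open>0 \<in> G\<close> \<open>C 0 0 = G\<close> by auto
  ultimately have "extend k G - {0} = (G - {0}) \<union> (C 2 0 \<union> (C 0 2 \<union> C 2 2))"
    using \<open>C 0 0 = G\<close> by blast
  moreover have fin: "finite (C u v)" for u v
    using G by (simp add: C_def)
  moreover have "(G - {0}) \<inter> (C 2 0 \<union> (C 0 2 \<union> C 2 2)) = {}"
    using disj[of 0 0 2 0] disj[of 0 0 0 2] disj[of 0 0 2 2] \<open>C 0 0 = G\<close> by auto
  moreover have "C 2 0 \<inter> (C 0 2 \<union> C 2 2) = {}"
    using disj[of 2 0 0 2] disj[of 2 0 2 2] by auto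
  moreover have "C 0 2 \<inter> C 2 2 = {}"
    using disj[of 0 2 2 2] by simp
  ultimately have ext: "mset_set (extend k G - {0})
      = mset_set (G - {0}) + (mset_set (C 2 0) + (mset_set (C 0 2) + mset_set (C 2 2)))"
    using G(2) by (simp add: mset_set_Union)
  have neg: "bij_betw uminus G G"
    by (rule bij_betw_byWitness[where f' = uminus]) (use G in \<open>auto simp: additive_subgroup_def\<close>)
  have pos_neg: "(\<Sum>x\<in>P. {#append_pair k (f x) u v#}) = mset_set (C u v)"
    "(\<Sum>x\<in>P. {#append_pair k (- f x) u v#}) = mset_set (C u v)" if "bij_betw f P G" for f u v
    using sum_singleton_mset[OF that, of "\<lambda>g. append_pair k g u v"]
      sum_singleton_mset[OF bij_betw_trans[OF that neg], of "\<lambda>g. append_pair k g u v"] C by simp_all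
  have neg_two: "- 2 = (2::4)"
    by simp
  have "shrikhande_mset (append_pair k g 2 0) (append_pair k h 0 2)
      = {#append_pair k g 2 0#} + {#append_pair k (- g) 2 0#} + {#append_pair k h 0 2#} + {#append_pair k (- h) 0 2#}
       + {#append_pair k (g + h) 2 2#} + {#append_pair k (- (g + h)) 2 2#}" for g h
    unfolding shrikhande_mset_def append_pair_add append_pair_minus add_0_left add_0_right neg_two by (simp add: add_mset_commute)
  then have "(\<Sum>x\<in>P. shrikhande_mset (append_pair k (fst x) 2 0) (append_pair k (snd x) 0 2))
     = mset_set (C 2 0) + mset_set (C 2 0) + mset_set (C 0 2) + mset_set (C 0 2) + mset_set (C 2 2) + mset_set (C 2 2)"
    using pos_neg[OF P(1)] pos_neg[OF P(2)] pos_neg[OF P(3)]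
    by (simp only: sum.distrib case_prod_beta)
  then show ?thesis
    unfolding twofold_mset_def ext by (simp only: ac_simps)
qed

lemma doob_map_extend:
  assumes adm: "admissible k G" and dm: "doob_map G m n (twofold_mset z G)"
    and j: "j \<le> card G" "elementary G \<or> j = card G"
  shows "doob_map (extend k G) (m + j) (n + 2 * (card G - j)) (twofold_mset z (extend k G))"
proof -
  have G: "additive_subgroup G" "finite G" and supp: "\<forall>g\<in>G. \<forall>i\<ge>k. g i = 0"
    using adm unfolding admissible_def by blast+
  obtain P where P: "bij_betw fst P G" "bij_betw snd P G" "bij_betw (\<lambda>(g, h). g + h) P G"
    using adm unfolding admissible_def by blast
  have card: "card P = card G" and fin: "finite P"
    using P(1) G(2) bij_betw_same_card bij_betw_finite by blast+
  have mem: "append_pair k g u v \<in> extend k G" if "g \<in> G" "u \<in> {0, 2}" "v \<in> {0, 2}" for g u v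
    unfolding extend_def using that by blast
  \<comment> \<open>Members of \<open>G\<close> vanish from \<open>k\<close> on, so padding them
    with zeros changes nothing and the old coordinate maps stay valid in the larger group.\<close>
  have "G \<subseteq> extend k G"
    using mem[of _ 0 0] supp append_pair_0 by fastforce
  show ?thesis
    unfolding twofold_mset_extend[OF adm P] card[symmetric]
  proof (rule doob_map_add_family[OF additive_subgroup_extend[OF G(1)]])
    show "doob_map (extend k G) m n (twofold_mset z G)"
      using doob_map_mono[OF dm \<open>G \<subseteq> extend k G\<close>] .
    show "append_pair k (fst x) 2 0 \<in> extend k G \<and> append_pair k (snd x) 0 2 \<in> extend k G" if "x \<in> P" for x
      using that P(1,2) by (auto intro!: mem dest: bij_betwE)
  qed (use fin card j elementary_extend in auto)
qed

text \<open>Stage \<open>i\<close> adds one Shrikhande coordinate, or two \<open>K4\<close>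
  coordinates, per element of the current group, whose order is \<open>card G * 4 ^ i\<close>; hence
  the geometric sum.\<close>

lemma doob_map_tower:
  assumes "admissible k G" and "doob_map G m n (twofold_mset z G)"
  shows "\<exists>k' G'. admissible k' G' \<and> card G' = card G * 4 ^ r \<and> (elementary G \<longrightarrow> elementary G')
    \<and> (\<forall>j. j \<le> card G * (\<Sum>i<r. 4 ^ i) \<and> (elementary G \<or> j = card G * (\<Sum>i<r. 4 ^ i))
        \<longrightarrow> doob_map G' (m + j) (n + 2 * (card G * (\<Sum>i<r. 4 ^ i) - j)) (twofold_mset z G'))"
proof (induction r)
  case 0
  then show ?case
    using assms by auto
next
  case (Suc r)
  let ?N = "card G * (\<Sum>i<r. 4 ^ i)"
  obtain k' G' where adm: "admissible k' G'" and card: "card G' = card G * 4 ^ r"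
    and el: "elementary G \<longrightarrow> elementary G'"
    and dm: "\<And>j. j \<le> ?N \<Longrightarrow> elementary G \<or> j = ?N
      \<Longrightarrow> doob_map G' (m + j) (n + 2 * (?N - j)) (twofold_mset z G')"
    using Suc.IH by blast
  have N: "card G * (\<Sum>i<Suc r. 4 ^ i) = ?N + card G'"
    by (simp add: card algebra_simps)
  have "doob_map (extend k' G') (m + j) (n + 2 * (?N + card G' - j)) (twofold_mset z (extend k' G'))"
    if j: "j \<le> ?N + card G'" "elementary G \<or> j = ?N + card G'" for j
  proof -
    \<comment> \<open>The earlier stages take as many Shrikhande coordinates as they can. If
      \<open>G\<close> is not elementary, \<open>j\<close> is maximal, and then so are
      \<open>i\<close> and \<open>j - i\<close>.\<close>
    define i where "i = min j ?N"
    have "i \<le> ?N" "j - i \<le> card G'" "i \<le> j"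
      using j(1) by (auto simp: i_def)
    have "elementary G \<or> i = ?N" "elementary G' \<or> j - i = card G'"
      using j(2) el by (auto simp: i_def)
    then have "doob_map (extend k' G') (m + i + (j - i)) (n + 2 * (?N - i) + 2 * (card G' - (j - i)))
        (twofold_mset z (extend k' G'))"
      using dm doob_map_extend[OF adm] \<open>i \<le> ?N\<close> \<open>j - i \<le> card G'\<close> by blast
    moreover have "m + i + (j - i) = m + j"
      "n + 2 * (?N - i) + 2 * (card G' - (j - i)) = n + 2 * (?N + card G' - j)"
      using \<open>i \<le> ?N\<close> \<open>j - i \<le> card G'\<close> \<open>i \<le> j\<close> by linarith+
    ultimately show ?thesis
      by (simp only:)
  qed
  then show ?case
    unfolding N using admissible_extend[OF adm] card_extend[OF adm] card el elementary_extend
    by (intro exI[of _ "k' + 2"] exI[of _ "extend k' G'"]) auto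
qed

section \<open>Groups of order eight\<close>

definition vec3 :: "4 \<Rightarrow> 4 \<Rightarrow> 4 \<Rightarrow> nat \<Rightarrow> 4" where
  "vec3 x y z = (\<lambda>i. if i = 0 then x else if i = 1 then y else if i = 2 then z else 0)"

lemma vec3_eq_iff: "vec3 x y z = vec3 x' y' z' \<longleftrightarrow> x = x' \<and> y = y' \<and> z = z'"
proof
  assume eq: "vec3 x y z = vec3 x' y' z'"
  show "x = x' \<and> y = y' \<and> z = z'"
    using fun_cong[OF eq, of 0] fun_cong[OF eq, of 1] fun_cong[OF eq, of 2] by (simp add: vec3_def)
qed simp

lemma vec3_add: "vec3 x y z + vec3 x' y' z' = vec3 (x + x') (y + y') (z + z')"
  by (simp add: vec3_def fun_eq_iff)

lemma vec3_minus: "- vec3 x y z = vec3 (- x) (- y) (- z)"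
  by (simp add: vec3_def fun_eq_iff)

lemma vec3_zero: "0 = vec3 0 0 0"
  by (simp add: vec3_def fun_eq_iff)

lemma vec3_support: "\<forall>i\<ge>3. vec3 x y z i = 0"
  by (simp add: vec3_def)

text \<open>The groups \<open>Z\<^sub>2\<^sup>3\<close> and \<open>Z\<^sub>4 \<times> Z\<^sub>2\<close>, with \<open>Z\<^sub>2\<close> embedded into \<open>Z\<^sub>4\<close> as \<open>{0, 2}\<close>.\<close>

definition cube :: "(nat \<Rightarrow> 4) set" where
  "cube =
    {vec3 0 0 0, vec3 0 0 2, vec3 0 2 0, vec3 0 2 2,
     vec3 2 0 0, vec3 2 0 2, vec3 2 2 0, vec3 2 2 2}"

definition cyclic_by_two :: "(nat \<Rightarrow> 4) set" where
  "cyclic_by_two =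
    {vec3 0 0 0, vec3 0 2 0, vec3 1 0 0, vec3 1 2 0,
     vec3 2 0 0, vec3 2 2 0, vec3 3 0 0, vec3 3 2 0}"

lemma Z4_numerals: "4 = (0::4)" "5 = (1::4)" "6 = (2::4)" "- 1 = (3::4)" "- 2 = (2::4)" "- 3 = (1::4)" "- 4 = (0::4)"
  by simp_all

lemma vec3_double: "2 * vec3 x y z = vec3 (2 * x) (2 * y) (2 * z)"
  by (simp add: vec3_def fun_eq_iff)

lemmas vec3_simps = vec3_eq_iff vec3_add vec3_minus vec3_zero vec3_double Z4_numerals

lemma additive_subgroup_cube: "additive_subgroup cube"
  unfolding additive_subgroup_def cube_def by (simp add: vec3_simps)

lemma additive_subgroup_cyclic_by_two: "additive_subgroup cyclic_by_two"
  unfolding additive_subgroup_def cyclic_by_two_def by (simp add: vec3_simps)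

lemma elementary_cube: "elementary cube"
  unfolding elementary_def cube_def by (simp add: vec3_simps)

lemma card_cube: "card cube = 8"
  unfolding cube_def by (simp add: vec3_eq_iff)

lemma card_cyclic_by_two: "card cyclic_by_two = 8"
  unfolding cyclic_by_two_def by (simp add: vec3_eq_iff)

lemma admissible_cube: "admissible 3 cube"
proof -
  \<comment> \<open>Multiplication by \<open>\<alpha>\<close> in the field with eight elements,
    where \<open>\<alpha>^3 = \<alpha> + 1\<close> and \<open>1\<close>, \<open>\<alpha>\<close>,
    \<open>\<alpha>^2\<close> are \<open>vec3 2 0 0\<close>, \<open>vec3 0 2 0\<close>,
    \<open>vec3 0 0 2\<close>; the sum map is multiplication by \<open>\<alpha> + 1\<close>.\<close>
  define P where "P =
    {(vec3 0 0 0, vec3 0 0 0), (vec3 0 0 2, vec3 2 2 0), (vec3 0 2 0, vec3 0 0 2),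
     (vec3 0 2 2, vec3 2 2 2), (vec3 2 0 0, vec3 0 2 0), (vec3 2 0 2, vec3 2 0 0),
     (vec3 2 2 0, vec3 0 2 2), (vec3 2 2 2, vec3 2 0 2)}"
  have "bij_betw fst P cube" "bij_betw snd P cube" "bij_betw (\<lambda>(g, h). g + h) P cube"
    unfolding bij_betw_def P_def cube_def by (simp_all add: vec3_eq_iff vec3_add Z4_numerals insert_commute)
  then have "\<exists>P. bij_betw fst P cube \<and> bij_betw snd P cube \<and> bij_betw (\<lambda>(g, h). g + h) P cube"
    by blast
  moreover have "finite cube" "\<forall>g\<in>cube. \<forall>i\<ge>3. g i = 0"
    unfolding cube_def using vec3_support by simp_all
  ultimately show ?thesis
    using additive_subgroup_cube unfolding admissible_def by blast
qed

lemma admissible_cyclic_by_two: "admissible 3 cyclic_by_two"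
proof -
  \<comment> \<open>No automorphism is a complete mapping here: it fixes \<open>vec3 2 0 0\<close>,
    the only nonzero double, and adding it to its image gives 0. Hence an explicit table that is not
    a homomorphism.\<close>
  define P where "P =
    {(vec3 0 0 0, vec3 0 0 0), (vec3 0 2 0, vec3 1 0 0), (vec3 1 0 0, vec3 1 2 0),
     (vec3 1 2 0, vec3 2 0 0), (vec3 2 0 0, vec3 2 2 0), (vec3 2 2 0, vec3 3 2 0),
     (vec3 3 0 0, vec3 3 0 0), (vec3 3 2 0, vec3 0 2 0)}"
  have "bij_betw fst P cyclic_by_two" "bij_betw snd P cyclic_by_two" "bij_betw (\<lambda>(g, h). g + h) P cyclic_by_two"
    unfolding bij_betw_def P_def cyclic_by_two_def by (simp_all add: vec3_eq_iff vec3_add Z4_numerals insert_commute)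
  then have "\<exists>P. bij_betw fst P cyclic_by_two \<and> bij_betw snd P cyclic_by_two
      \<and> bij_betw (\<lambda>(g, h). g + h) P cyclic_by_two"
    by blast
  moreover have "finite cyclic_by_two" "\<forall>g\<in>cyclic_by_two. \<forall>i\<ge>3. g i = 0"
    unfolding cyclic_by_two_def using vec3_support by simp_all
  ultimately show ?thesis
    using additive_subgroup_cyclic_by_two unfolding admissible_def by blast
qed

text \<open>The degenerate triple with \<open>p = q\<close> supplies the single \<open>0\<close> and
  one element twice. The others combine each of \<open>vec3 0 2 0\<close>, \<open>vec3 2 2 0\<close>
  with each of \<open>vec3 0 0 2\<close>, \<open>vec3 2 0 2\<close>, and their four sums take two
  values twice each.\<close>

lemma twofold_mset_cube:
  "twofold_mset 1 cube = {#} + {#vec3 2 0 0, vec3 2 0 0, vec3 2 0 0 + vec3 2 0 0#}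
    + {#vec3 0 2 0, vec3 0 0 2, vec3 0 2 0 + vec3 0 0 2#}
    + {#vec3 0 2 0, vec3 2 0 2, vec3 0 2 0 + vec3 2 0 2#}
    + {#vec3 2 2 0, vec3 0 0 2, vec3 2 2 0 + vec3 0 0 2#}
    + {#vec3 2 2 0, vec3 2 0 2, vec3 2 2 0 + vec3 2 0 2#}"
  unfolding twofold_mset_def cube_def by (simp add: vec3_simps add_mset_commute)

text \<open>Each Shrikhande term contains every element of order 4 once and the involution
  \<open>a + b\<close> twice; the degenerate triple supplies \<open>0\<close> and the third
  involution.\<close>

lemma twofold_mset_cyclic_by_two_2_1:
  "twofold_mset 1 cyclic_by_two = {#} + {#vec3 2 0 0, vec3 2 0 0, vec3 2 0 0 + vec3 2 0 0#}
    + shrikhande_mset (vec3 1 0 0) (vec3 1 2 0) + shrikhande_mset (vec3 1 0 0) (vec3 3 2 0)"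
  unfolding twofold_mset_def cyclic_by_two_def shrikhande_mset_def
  by (simp add: vec3_simps add_mset_commute)

text \<open>The two cyclic triples replace one Shrikhande term: together they contain every element
  of order 4 once and their common double \<open>vec3 2 0 0\<close> twice.\<close>

lemma twofold_mset_cyclic_by_two_1_3:
  "twofold_mset 1 cyclic_by_two = {#} + {#vec3 1 0 0, vec3 1 0 0 + vec3 1 0 0, - vec3 1 0 0#}
    + {#vec3 1 2 0, vec3 1 2 0 + vec3 1 2 0, - vec3 1 2 0#}
    + {#vec3 2 2 0, vec3 2 2 0, vec3 2 2 0 + vec3 2 2 0#}
    + shrikhande_mset (vec3 1 0 0) (vec3 3 2 0)"
  unfolding twofold_mset_def cyclic_by_two_def shrikhande_mset_def
  by (simp add: vec3_simps add_mset_commute)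

text \<open>Taking \<open>b = - a\<close> in the first two terms makes \<open>a + b\<close> vanish,
  which produces the four zeros.\<close>

lemma twofold_mset_cyclic_by_two_3_0:
  "twofold_mset 4 cyclic_by_two = {#} + shrikhande_mset (vec3 1 0 0) (vec3 3 0 0)
    + shrikhande_mset (vec3 1 2 0) (vec3 3 2 0) + shrikhande_mset (vec3 2 0 0) (vec3 0 2 0)"
  unfolding twofold_mset_def cyclic_by_two_def shrikhande_mset_def
  by (simp add: vec3_simps add_mset_commute eval_nat_numeral)

lemma doob_map_cube: "doob_map cube 0 5 (twofold_mset 1 cube)"
proof -
  have "doob_map cube 0 (Suc (Suc (Suc (Suc (Suc 0))))) (twofold_mset 1 cube)"
    unfolding twofold_mset_cube
    by (intro doob_map_add_K4_elementary additive_subgroup_cube doob_map_empty) (simp_all add: cube_def vec3_simps)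
  then show ?thesis
    by (simp add: eval_nat_numeral)
qed

lemma doob_map_cyclic_by_two_2_1: "doob_map cyclic_by_two 2 1 (twofold_mset 1 cyclic_by_two)"
proof -
  have "doob_map cyclic_by_two (Suc (Suc 0)) (Suc 0) (twofold_mset 1 cyclic_by_two)"
    unfolding twofold_mset_cyclic_by_two_2_1
    by (intro doob_map_add_shrikhande doob_map_add_K4_elementary additive_subgroup_cyclic_by_two doob_map_empty)
      (simp_all add: cyclic_by_two_def vec3_simps)
  then show ?thesis
    by (simp add: eval_nat_numeral)
qed

lemma doob_map_cyclic_by_two_1_3: "doob_map cyclic_by_two 1 3 (twofold_mset 1 cyclic_by_two)"
proof -
  have "doob_map cyclic_by_two (Suc 0) (Suc (Suc (Suc 0))) (twofold_mset 1 cyclic_by_two)"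
    unfolding twofold_mset_cyclic_by_two_1_3
    by (rule doob_map_add_shrikhande doob_map_add_K4_elementary doob_map_add_K4_cyclic
        additive_subgroup_cyclic_by_two doob_map_empty; (simp add: cyclic_by_two_def vec3_simps; fail)?)+
  then show ?thesis
    by (simp add: eval_nat_numeral)
qed

lemma doob_map_cyclic_by_two_3_0: "doob_map cyclic_by_two 3 0 (twofold_mset 4 cyclic_by_two)"
proof -
  have "doob_map cyclic_by_two (Suc (Suc (Suc 0))) 0 (twofold_mset 4 cyclic_by_two)"
    unfolding twofold_mset_cyclic_by_two_3_0
    by (intro doob_map_add_shrikhande additive_subgroup_cyclic_by_two doob_map_empty)
      (simp_all add: cyclic_by_two_def vec3_simps)
  then show ?thesis
    by (simp add: eval_nat_numeral)
qed

section \<open>Colorings at every level of the tower\<close>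

lemma perfect_coloring_tower:
  fixes b c :: nat
  assumes adm: "admissible k G" and dm: "doob_map G m n (twofold_mset z G)" and "card G = 8"
    and j: "j \<le> 8 * (\<Sum>i<r. 4 ^ i)" "elementary G \<or> j = 8 * (\<Sum>i<r. 4 ^ i)"
    and bc: "even b" "even c" "b > 0" "c > 0" "b + c = 16 * 4 ^ r"
  shows "\<exists>f :: _ \<Rightarrow> 2. perfect_coloring (doob_vertices (m + j) (n + 2 * (8 * (\<Sum>i<r. 4 ^ i) - j)))
    (doob_adj (m + j) (n + 2 * (8 * (\<Sum>i<r. 4 ^ i) - j))) f
    (vector [vector [c - 2 + z, b], vector [c, b - 2 + z]])"
proof -
  obtain k' G' where adm': "admissible k' G'" and card: "card G' = 8 * 4 ^ r"
    and dm': "doob_map G' (m + j) (n + 2 * (8 * (\<Sum>i<r. 4 ^ i) - j)) (twofold_mset z G')"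
    using doob_map_tower[OF adm dm, of r] j unfolding \<open>card G = 8\<close> by blast
  have G': "additive_subgroup G'" "finite G'"
    using adm' unfolding admissible_def by blast+
  \<comment> \<open>As \<open>b + c = 2 * card G'\<close>, giving color 1 to \<open>c / 2\<close>
    fibres leaves \<open>b / 2\<close> fibres for color 2.\<close>
  have "c div 2 \<le> card G'"
    using bc(5) card by linarith
  then obtain T where T: "T \<subseteq> G'" "card T = c div 2" "finite T"
    by (rule obtain_subset_with_card_n)
  have c: "2 * card T = c"
    using bc(2) T(2) by simp
  moreover have b: "2 * card (G' - T) = b"
    using bc(5) c card T by (simp add: card_Diff_subset)
  moreover have "T \<noteq> {}" "T \<noteq> G'"
    using b c bc(3,4) by auto
  moreover have "2 * (card T - 1) = c - 2" "2 * (card (G' - T) - 1) = b - 2"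
    using b c by simp_all
  ultimately show ?thesis
    using perfect_coloring_of_doob_map[OF G' dm' T(1)] by simp
qed

theorem theorem5:
  fixes b c l :: nat
  assumes "b > 0" and "c > 0"
    and "gcd b c = 2"
    and "l \<ge> 2"
    and "(b + c) div 2 = 2 ^ (2 * l - 1)"
  shows "(\<forall>m n. 2 * m + n = (2 ^ (2 * l) - 1) div 3 \<longrightarrow>
            (\<exists>f :: _ \<Rightarrow> 2. perfect_coloring (doob_vertices m n) (doob_adj m n) f
               (vector [vector [c - 1, b], vector [c, b - 1]])))
       \<and> (\<forall>m. 2 * m = (2 ^ (2 * l) + 2) div 3 \<longrightarrow>
            (\<exists>f :: _ \<Rightarrow> 2. perfect_coloring (doob_vertices m 0) (doob_adj m 0) f
               (vector [vector [c + 2, b], vector [c, b + 2]])))"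
proof -
  \<comment> \<open>The tower starts with order 8 at \<open>l = 2\<close>; after \<open>r\<close>
    extensions the order is \<open>2 ^ (2 * l - 1)\<close>, and \<open>N\<close> Shrikhande
    coordinates, up to trading, have been added.\<close>
  define r where "r = l - 2"
  define N :: nat where "N = 8 * (\<Sum>i<r. 4 ^ i)"
  have l: "l = r + 2"
    using \<open>l \<ge> 2\<close> by (simp add: r_def)
  have "even b" "even c"
    using \<open>gcd b c = 2\<close> by (metis gcd_dvd1, metis gcd_dvd2)
  have "2 ^ (2 * l - 1) = 8 * (4 ^ r :: nat)"
    by (simp add: l power_add power_mult)
  then have bc: "b + c = 16 * 4 ^ r"
    using assms(5) \<open>even b\<close> \<open>even c\<close> by (metis dvd_mult_div_cancel even_add mult.assoc mult_2 numeral_Bit0 numeral_times_numeral)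
  have pow: "2 ^ (2 * l) = 16 * (4 ^ r :: nat)"
    by (simp add: l power_add power_mult)
  have "3 * (\<Sum>i<r. 4 ^ i) + 1 = (4 ^ r :: nat)"
    by (induction r) auto
  then have N: "16 * (4 ^ r :: nat) = 6 * N + 16"
    by (simp add: N_def)
  \<comment> \<open>Subtraction on naturals truncates, so this is needed to rewrite
    \<open>c - 2 + z\<close> as \<open>c - 1\<close> or \<open>c + 2\<close>.\<close>
  have ge: "b \<ge> 2" "c \<ge> 2"
    using \<open>even b\<close> \<open>even c\<close> assms(1,2) by presburger+
  note tower = perfect_coloring_tower[where r = r and b = b and c = c, folded N_def,
      OF _ _ _ _ _ \<open>even b\<close> \<open>even c\<close> assms(1,2) bc]
  have "\<exists>f :: _ \<Rightarrow> 2. perfect_coloring (doob_vertices m n) (doob_adj m n) f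
      (vector [vector [c - 1, b], vector [c, b - 1]])"
    if mn: "2 * m + n = (2 ^ (2 * l) - 1) div 3" for m n
  proof -
    have mn: "2 * m + n = 2 * N + 5"
      using mn unfolding pow N by simp
    have sub: "c - 2 + 1 = c - 1" "b - 2 + 1 = b - 1"
      using ge by simp_all
    \<comment> \<open>For \<open>m \<le> N\<close> at least five \<open>K4\<close> coordinates
      remain and the elementary tower over \<open>cube\<close> applies. The other two values leave
      only three or one, and use the base solutions in \<open>cyclic_by_two\<close> with all
      \<open>N\<close> added coordinates Shrikhande.\<close>
    consider "m \<le> N" | "m = N + 1" | "m = N + 2"
      using mn by linarith
    then show ?thesis
    proof cases
      case 1
      then have "n = 5 + 2 * (N - m)"
        using mn by linarith
      then show ?thesis
        using tower[OF admissible_cube doob_map_cube card_cube 1] elementary_cube sub by simp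
    next
      case 2
      then have "n = 3"
        using mn by linarith
      then show ?thesis
        using tower[OF admissible_cyclic_by_two doob_map_cyclic_by_two_1_3 card_cyclic_by_two order_refl] 2 sub
        by (simp add: add.commute)
    next
      case 3
      then have "n = 1"
        using mn by linarith
      then show ?thesis
        using tower[OF admissible_cyclic_by_two doob_map_cyclic_by_two_2_1 card_cyclic_by_two order_refl] 3 sub
        by simp
    qed
  qed
  moreover have "\<exists>f :: _ \<Rightarrow> 2. perfect_coloring (doob_vertices m 0) (doob_adj m 0) f
      (vector [vector [c + 2, b], vector [c, b + 2]])"
    if m: "2 * m = (2 ^ (2 * l) + 2) div 3" for m
  proof -
    have "m = N + 3"
      using m unfolding pow N by simp
    moreover have "c - 2 + 4 = c + 2" "b - 2 + 4 = b + 2"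
      using ge by simp_all
    ultimately show ?thesis
      using tower[OF admissible_cyclic_by_two doob_map_cyclic_by_two_3_0 card_cyclic_by_two order_refl]
      by (simp add: add.commute)
  qed
  ultimately show ?thesis
    by blast
qed

end
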